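(* Let $0 \le a < b < \infty$, let $\alpha \in [0,1]$, $m \in (0,1]$, $s \in (0,1]$, and let $p, q > 0$ be fixed real numbers. Let $f : [0,\infty) \to \mathbb{R}$ be a function whose restriction to $[a,b]$ is continuous and satisfies $f \in L([a,b])$. If $|f|$ belongs to the class $K_{m,1}^{\alpha,s}$ on $[a,b]$, then $$\int_a^b (x-a)^p (b-x)^q f(x)\,dx \le (b-a)^{p+q+1}\left\{ \beta(q+\alpha s+1,\, p+1)\left( |f(a)| - m\left|f\left(\tfrac{b}{m}\right)\right| \right) + m\,\beta(q+1,\, p+1)\left|f\left(\tfrac{b}{m}\right)\right| \right\}.$$
   Context: $\beta(x,y) = \int_0^1 t^{x-1}(1-t)^{y-1}\,dt$ (for $x,y>0$) is the Euler Beta function. $L([a,b])$ denotes the Lebesgue integrable functions on $[a,b]$. A function $g : [0,\infty) \to [0,\infty)$ is said to belong to the class $K_{m,1}^{\alpha,s}$ on $[a,b]$ ($s$-$(\alpha,m)$-convex in the first sense) if for all $x, y \in [a,b]$ and all $\mu \in [0,1]$, $$g(\mu x + (1-\mu) y) \le \mu^{\alpha s}\, g(x) + m\,(1-\mu^{\alpha s})\, g\left(\frac{y}{m}\right).$$ *)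

theory Defs
  imports "HOL-Analysis.Analysis"
begin

text \<open>
  The real power \<open>x\<close> to the \<open>r\<close> with the convention that \<open>0\<close> to the \<open>0\<close> is \<open>1\<close>; the library has
  \<open>0 powr 0 = 0\<close>. The two differ only at this point.
\<close>

definition real_pow :: "real \<Rightarrow> real \<Rightarrow> real"
  where "real_pow x r = (if r = 0 then 1 else x powr r)"

text \<open>
  Functions on \<open>[0,\<infinity>)\<close> are represented by total functions on the reals; for \<open>0 \<le> a\<close> and \<open>0 < m\<close>
  the values at negative arguments play no role.
\<close>

definition s_alpha_m_convex_first :: "real \<Rightarrow> real \<Rightarrow> real \<Rightarrow> real \<Rightarrow> real \<Rightarrow> (real \<Rightarrow> real) set"
  where "s_alpha_m_convex_first \<alpha> s m a b =
    {g. (\<forall>x\<ge>0. 0 \<le> g x) \<and>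
        (\<forall>x\<in>{a..b}. \<forall>y\<in>{a..b}. \<forall>\<mu>\<in>{0..1}.
           g (\<mu> * x + (1 - \<mu>) * y)
             \<le> real_pow \<mu> (\<alpha> * s) * g x + m * (1 - real_pow \<mu> (\<alpha> * s)) * g (y / m))}"

text \<open>
  The library defines \<^const>\<open>Beta\<close> through the Gamma function; for positive real arguments it is
  Euler's integral.
\<close>

lemma Beta_eq_Euler_integral:
  fixes x y :: real
  assumes "x > 0" "y > 0"
  shows "Beta x y = (LINT t:{0..1}|lebesgue. t powr (x - 1) * (1 - t) powr (y - 1))"
proof -
  let ?h = "\<lambda>t::real. t powr (x - 1) * (1 - t) powr (y - 1)"
  have I: "(?h has_integral Beta x y) {0..1}"
    using has_integral_Beta_real[OF assms] .
  have "?h absolutely_integrable_on {0..1}"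
    by (rule nonnegative_absolutely_integrable_1) (use I in \<open>auto simp: integrable_on_def\<close>)
  then have "(LINT t:{0..1}|lebesgue. ?h t) = integral {0..1} ?h"
    by (rule set_lebesgue_integral_eq_integral(2))
  with I show ?thesis
    by (simp add: integral_unique)
qed

end

theory Submission
  imports Defs
begin

text \<open>
  Write \<open>x \<in> [a,b]\<close> as the convex combination \<open>\<mu> a + (1 - \<mu>) b\<close> with \<open>\<mu> = (b - x) / (b - a)\<close>.
  Convexity in the first sense then bounds \<open>\<bar>f x\<bar>\<close> by
  \<open>\<mu>\<close> to the \<open>\<alpha> s\<close> times \<open>\<bar>f a\<bar> - m \<bar>f (b/m)\<bar>\<close>, plus the constant \<open>m \<bar>f (b/m)\<bar>\<close>.
  Both the weight \<open>(x - a)\<^sup>p (b - x)\<^sup>q\<close> and its product with a power of \<open>\<mu>\<close> are of the form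
  \<open>(b - x)\<^sup>u (x - a)\<^sup>v\<close> up to a constant, and the integral of such a function over \<open>[a,b]\<close> is Euler's
  Beta integral, stretched from the unit interval (\<open>has_integral_Beta_interval\<close>). Multiplying the
  pointwise bound by the weight and integrating gives the two Beta terms.
\<close>

text \<open>
  The substitution \<open>t = (b - x) / (b - a)\<close> turns this into Euler's integral over \<open>[0,1]\<close>. It
  reverses the interval, so that the exponent of \<open>b - x\<close> becomes the first argument of Beta.
\<close>

lemma has_integral_Beta_interval:
  fixes a b u v :: real
  assumes "a < b" "u > -1" "v > -1"
  shows "((\<lambda>x. (b - x) powr u * (x - a) powr v) has_integral
           (b - a) powr (u + v + 1) * Beta (u + 1) (v + 1)) {a..b}"
proof -
  define d where "d = b - a"
  have d: "d > 0" using assms by (simp add: d_def)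
  have "((\<lambda>t. t powr u * (1 - t) powr v) has_integral Beta (u + 1) (v + 1)) (cbox 0 1)"
    using has_integral_Beta_real[of "u + 1" "v + 1"] assms by simp
  from has_integral_affinity[OF this, of "- 1 / d" "b / d"] d
  have "((\<lambda>x. (- 1 / d * x + b / d) powr u * (1 - (- 1 / d * x + b / d)) powr v) has_integral
          d * Beta (u + 1) (v + 1)) ((\<lambda>x. b - d * x) ` {0..1})"
    by (simp add: algebra_simps)
  moreover have "(\<lambda>x. b - d * x) ` {0..1} = {a..b}"
  proof -
    have "(\<lambda>x. b - d * x) ` {0..1} = (\<lambda>x. (- d) * x + b) ` {0..1}" by simp
    also have "\<dots> = {a..b}" using d by (subst image_affinity_atLeastAtMost) (auto simp: d_def)
    finally show ?thesis .
  qed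
  ultimately have "((\<lambda>x. (- 1 / d * x + b / d) powr u * (1 - (- 1 / d * x + b / d)) powr v)
      has_integral d * Beta (u + 1) (v + 1)) {a..b}"
    by simp
  from has_integral_mult_right[OF this, of "d powr (u + v)"]
  have "((\<lambda>x. d powr (u + v) *
          ((- 1 / d * x + b / d) powr u * (1 - (- 1 / d * x + b / d)) powr v))
      has_integral (b - a) powr (u + v + 1) * Beta (u + 1) (v + 1)) {a..b}"
    using d by (simp add: powr_add d_def mult_ac)
  moreover have "d powr (u + v) *
          ((- 1 / d * x + b / d) powr u * (1 - (- 1 / d * x + b / d)) powr v)
        = (b - x) powr u * (x - a) powr v" if "x \<in> {a..b}" for x
  proof -
    have "- 1 / d * x + b / d = (b - x) / d" "1 - (- 1 / d * x + b / d) = (x - a) / d"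
      using d by (simp_all add: field_simps) (simp add: d_def)
    then show ?thesis
      using d that by (simp add: powr_divide powr_add)
  qed
  ultimately show ?thesis
    by (rule has_integral_eq[rotated])
qed

theorem theorem4:
  fixes a b \<alpha> m s p q :: real and f :: "real \<Rightarrow> real"
  assumes "0 \<le> a" and "a < b"
    and "\<alpha> \<in> {0..1}" and "m \<in> {0<..1}" and "s \<in> {0<..1}"
    and "p > 0" and "q > 0"
    and "continuous_on {a..b} f"
    and "f absolutely_integrable_on {a..b}"
    and "(\<lambda>x. \<bar>f x\<bar>) \<in> s_alpha_m_convex_first \<alpha> s m a b"
  shows "(LINT x:{a..b}|lebesgue. (x - a) powr p * (b - x) powr q * f x)
    \<le> (b - a) powr (p + q + 1) *
        (Beta (q + \<alpha> * s + 1) (p + 1) * (\<bar>f a\<bar> - m * \<bar>f (b / m)\<bar>)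
         + m * Beta (q + 1) (p + 1) * \<bar>f (b / m)\<bar>)"
proof -
  let ?F = "\<lambda>x. (x - a) powr p * (b - x) powr q * f x"
  define r where "r = \<alpha> * s"
  define d where "d = b - a"
  define C where "C = \<bar>f (b / m)\<bar>"
  have r: "r \<ge> 0" using assms by (simp add: r_def)
  have d: "d > 0" using assms by (simp add: d_def)
  let ?w = "\<lambda>u x. (b - x) powr u * (x - a) powr p"
  let ?G = "\<lambda>x. ?w (q + r) x * ((\<bar>f a\<bar> - m * C) / d powr r) + ?w q x * (m * C)"
  have "(?G has_integral
      (d powr (q + r + p + 1) * Beta (q + r + 1) (p + 1)) * ((\<bar>f a\<bar> - m * C) / d powr r)
      + (d powr (q + p + 1) * Beta (q + 1) (p + 1)) * (m * C)) {a..b}"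
    unfolding d_def using assms r
    by (intro has_integral_add has_integral_mult_left has_integral_Beta_interval) auto
  moreover have "(d powr (q + r + p + 1) * Beta (q + r + 1) (p + 1)) * ((\<bar>f a\<bar> - m * C) / d powr r)
      + (d powr (q + p + 1) * Beta (q + 1) (p + 1)) * (m * C) =
      d powr (p + q + 1) * (Beta (q + r + 1) (p + 1) * (\<bar>f a\<bar> - m * C) + m * Beta (q + 1) (p + 1) * C)"
    using d by (simp add: powr_add field_simps)
  ultimately have G: "(?G has_integral
      d powr (p + q + 1) * (Beta (q + r + 1) (p + 1) * (\<bar>f a\<bar> - m * C) + m * Beta (q + 1) (p + 1) * C))
      {a..b}"
    by simp
  have "continuous_on {a..b} ?F"
    using assms by (intro continuous_intros continuous_on_powr') auto
  then have F: "?F absolutely_integrable_on {a..b}"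
    by (rule absolutely_integrable_continuous_real)
  have bound: "?F x \<le> ?G x" if x: "x \<in> {a..b}" for x
  proof (cases "x = b")
    \<comment> \<open>Here \<open>\<mu> = 0\<close>, so for \<open>r = 0\<close> the factor \<open>real_pow \<mu> r = 1\<close> is not \<open>\<mu> powr r = 0\<close>; the
      estimate survives because the powers of \<open>b - x\<close> make both sides vanish.\<close>
    case True
    then show ?thesis by simp
  next
    case False
    define \<mu> where "\<mu> = (b - x) / d"
    have \<mu>: "\<mu> \<in> {0..1}" "\<mu> > 0" using x False d by (auto simp: \<mu>_def d_def)
    have eq: "\<mu> * a + (1 - \<mu>) * b = x"
    proof -
      have "\<mu> * d = b - x" using d by (simp add: \<mu>_def)
      then show ?thesis by (simp add: d_def algebra_simps)
    qed
    have "\<bar>f (\<mu> * a + (1 - \<mu>) * b)\<bar>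
        \<le> real_pow \<mu> (\<alpha> * s) * \<bar>f a\<bar> + m * (1 - real_pow \<mu> (\<alpha> * s)) * \<bar>f (b / m)\<bar>"
      using assms(2,10) \<mu>(1) unfolding s_alpha_m_convex_first_def by auto
    then have "f x \<le> real_pow \<mu> r * (\<bar>f a\<bar> - m * C) + m * C"
      unfolding eq r_def C_def by (simp add: algebra_simps)
    also have "real_pow \<mu> r = (b - x) powr r / d powr r"
      using \<mu>(2) d x by (auto simp: real_pow_def \<mu>_def powr_divide)
    finally have "?F x \<le> ((x - a) powr p * (b - x) powr q) *
        ((b - x) powr r / d powr r * (\<bar>f a\<bar> - m * C) + m * C)"
      by (rule mult_left_mono) simp
    also have "\<dots> = ?G x"
      by (simp add: powr_add algebra_simps)
    finally show ?thesis .
  qed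
  have "(LINT x:{a..b}|lebesgue. ?F x) = integral {a..b} ?F"
    using F by (rule set_lebesgue_integral_eq_integral(2))
  also have "\<dots> \<le> integral {a..b} ?G"
    by (rule integral_le[OF set_lebesgue_integral_eq_integral(1)[OF F] has_integral_integrable[OF G] bound])
  also note integral_unique[OF G]
  finally show ?thesis
    by (simp add: r_def d_def C_def)
qed

end
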